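(* Let $n$ be a nonnegative integer and let $E_1, E_2 \subseteq \mathbb{T}$ each be a union of at most $n$ arcs. If $\widehat{E_1}(k) = \widehat{E_2}(k)$ for all integers $k$ with $0 \leq k \leq n$, then $E_1 = E_2$.
   Context: $\mathbb{T} = \{z \in \mathbb{C} : |z| = 1\}$. For a subset $E \subseteq \mathbb{T}$ and an integer $k$, $\widehat{E}(k) = \frac{1}{2\pi}\int_0^{2\pi} \chi_E(e^{it}) e^{-ikt}\,dt$ is the $k$th Fourier coefficient of the characteristic function $\chi_E$ of $E$. An arc is by definition a closed, connected, proper and nonempty subset of $\mathbb{T}$. By convention, $\mathbb{T}$ along with the empty set is declared to be a "union of $0$ arcs".
   Formalization: Arcs are additionally required to contain more than one point; with one-point arcs allowed the claim fails, e.g. n = 1, E_1 = {1}, E_2 = {i}, whose Fourier coefficients all vanish. *)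

theory Defs
  imports "HOL-Analysis.Analysis"
begin

abbreviation unit_circle :: "complex set" where
  "unit_circle \<equiv> sphere 0 1"

text \<open>
  Arcs are understood to be nondegenerate. A one-point set is closed, connected, proper and
  nonempty too, but all its Fourier coefficients vanish, like those of the empty set or of any
  other point, so no determination result can hold if one-point sets count as arcs.
\<close>

definition circle_arc :: "complex set \<Rightarrow> bool" where
  "circle_arc A \<longleftrightarrow>
     A \<subseteq> unit_circle \<and> closed A \<and> connected A \<and> A \<noteq> unit_circle \<and> A \<noteq> {} \<and> \<not> is_singleton A"

text \<open>
  For \<open>m = 0\<close> the second disjunct gives the empty set; the first adds the whole circle.
\<close>

definition union_of_arcs :: "nat \<Rightarrow> complex set \<Rightarrow> bool" where
  "union_of_arcs m E \<longleftrightarrow>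
     (m = 0 \<and> E = unit_circle) \<or>
     (\<exists>\<A>. finite \<A> \<and> card \<A> = m \<and> (\<forall>A\<in>\<A>. circle_arc A) \<and> E = \<Union>\<A>)"

definition fourier_coeff :: "complex set \<Rightarrow> int \<Rightarrow> complex" where
  "fourier_coeff E k =
     1 / (2 * of_real pi) *
     integral {0..2 * pi}
       (\<lambda>t. indicator E (exp (\<i> * of_real t)) * exp (- \<i> * of_int k * of_real t))"

end

theory Submission
  imports Defs
begin

text \<open>
  The proof counts sign changes. Put \<open>f = \<chi>\<^bsub>E\<^esub> - \<chi>\<^bsub>F\<^esub>\<close>. As \<open>f\<close> is real, conjugation gives its
  coefficients of index \<open>-n, \<dots>, -1\<close> from those of index \<open>1, \<dots>, n\<close>, so the hypothesis says that
  \<open>f\<close> is orthogonal to every trigonometric polynomial of degree at most \<open>n\<close>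
  (\<open>orthogonal_upto_char_diff\<close>).

  On the one hand, an orthogonal function that is not negligible changes sign often. If \<open>f\<close> changed
  sign at no more than \<open>2 n\<close> points \<open>d\<close> of the period, the product of the functions
  \<open>sin ((d - t) / 2)\<close> would be, after padding to an even number of factors, a trigonometric
  polynomial of degree at most \<open>n\<close>; its product with \<open>f\<close> would have constant sign and integral
  zero, hence would vanish wherever \<open>f\<close> is continuous, although the polynomial has only finitely
  many zeros. This is \<open>orthogonal_upto_alternates\<close>.

  On the other hand, \<open>f\<close> cannot change sign often. It is positive only at points of \<open>E - F\<close> and
  negative only at points of \<open>F - E\<close>. If such points alternate \<open>2 n + 2\<close> times around the circle, then
  \<open>n + 1\<close> points of \<open>E\<close> are pairwise separated by points outside \<open>E\<close>, so they lie in different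
  arcs of \<open>E\<close> (\<open>connected_not_separated\<close>, \<open>not_alternates_char_diff\<close>).

  The two bounds are played against each other through \<open>f\<close> and \<open>- f\<close> together: orthogonality gives
  an alternation of length \<open>2 n + 1\<close> that begins with a positive value and another that begins with
  a negative value, and putting the earlier of the two first points before the other sequence gives
  length \<open>2 n + 2\<close>.

  Finally, if \<open>E \<noteq> F\<close> then \<open>f\<close> is a nonzero constant on some interval, since arcs are nondegenerate
  and the sets are closed (\<open>interval_in_difference\<close>); this is what makes \<open>f\<close> not negligible.
\<close>

section \<open>Alternating sequences and sign changes\<close>

definition alternates :: "nat \<Rightarrow> (real \<Rightarrow> real) \<Rightarrow> real set \<Rightarrow> bool" where
  "alternates m f S \<longleftrightarrow>
     (\<exists>x :: nat \<Rightarrow> real. (\<forall>i j. i < j \<longrightarrow> j < m \<longrightarrow> x i < x j) \<and>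
        (\<forall>i<m. x i \<in> S \<and> (-1) ^ i * f (x i) > 0))"

lemma alternates_prepend:
  assumes y: "y \<in> S" "f y > 0"
    and mono: "\<And>i j. i < j \<Longrightarrow> j < m \<Longrightarrow> x i < x j"
    and x: "\<And>i. i < m \<Longrightarrow> x i \<in> S \<and> (-1) ^ i * (- f (x i)) > 0"
    and less: "0 < m \<Longrightarrow> y < x 0"
  shows "alternates (Suc m) f S"
proof -
  define z where "z = (\<lambda>i. case i of 0 \<Rightarrow> y | Suc j \<Rightarrow> x j)"
  have yx: "y < x j" if "j < m" for j
    using less mono[of 0 j] that by (cases j) auto
  have "z i < z j" if "i < j" "j < Suc m" for i j
    using that yx mono unfolding z_def by (auto split: nat.splits)
  moreover have "z i \<in> S \<and> (-1) ^ i * f (z i) > 0" if "i < Suc m" for i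
    using that y x unfolding z_def by (auto split: nat.splits)
  ultimately show ?thesis unfolding alternates_def by blast
qed

text \<open>
  The cuts \<open>ds\<close> are the successive infima of the places where the sign that is due next occurs:
  left of the first cut \<open>f \<le> 0\<close>, and right of it \<open>- f\<close> has a shorter maximal alternation. The
  factors are \<open>d - t\<close> rather than \<open>t - d\<close> so that all of them are positive on the far left, which
  fixes the sign of the product whatever the number of cuts. The infimum may or may not be attained;
  the induction can discard it because the product vanishes at a cut.
\<close>

lemma sign_change_points:
  fixes f :: "real \<Rightarrow> real"
  assumes "\<not> alternates (Suc m) f S" "S \<subseteq> {l..u}"
  shows "\<exists>ds. length ds \<le> m \<and> set ds \<subseteq> {l..u} \<and> (\<forall>t\<in>S. f t * prod_list (map (\<lambda>d. d - t) ds) \<le> 0)"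
  using assms
proof (induction m arbitrary: f S l)
  case 0
  have "f t \<le> 0" if "t \<in> S" for t
    using "0.prems"(1) alternates_prepend[of t S f 0] that by force
  then show ?case by auto
next
  case (Suc m)
  show ?case
  proof (cases "\<forall>t\<in>S. f t \<le> 0")
    case True
    then show ?thesis by (intro exI[of _ "[]"]) auto
  next
    case False
    define P where "P = {t\<in>S. f t > 0}"
    define a where "a = Inf P"
    have P: "P \<noteq> {}" "P \<subseteq> {l..u}" using False Suc.prems(2) by (auto simp: P_def not_le)
    then have bdd: "bdd_below P" by (meson bdd_below_Icc bdd_below_mono)
    have a: "l \<le> a" "a \<le> u"
      using P bdd by (auto simp: a_def intro!: cInf_greatest)
        (meson atLeastAtMost_iff cInf_lower ex_in_conv order_trans subset_eq)
    have left: "f t \<le> 0" if "t \<in> S" "t < a" for t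
      using that bdd cInf_lower[of t P] by (force simp: a_def P_def)
    have "\<not> alternates (Suc m) (\<lambda>t. - f t) (S \<inter> {a<..})"
    proof
      assume "alternates (Suc m) (\<lambda>t. - f t) (S \<inter> {a<..})"
      then obtain x where mono: "\<And>i j. i < j \<Longrightarrow> j < Suc m \<Longrightarrow> x i < x j"
        and x: "\<And>i. i < Suc m \<Longrightarrow> x i \<in> S \<inter> {a<..} \<and> (-1) ^ i * (- f (x i)) > 0"
        unfolding alternates_def by blast
      have "Inf P < x 0" using x[of 0] by (simp add: a_def)
      then obtain y where "y \<in> P" "y < x 0"
        using cInf_less_iff[OF P(1) bdd] by blast
      then have "alternates (Suc (Suc m)) f S"
        using x by (intro alternates_prepend[of y _ _ _ x] mono) (auto simp: P_def)
      then show False using Suc.prems(1) by blast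
    qed
    from Suc.IH[OF this, of a] Suc.prems(2) obtain ds where ds: "length ds \<le> m" "set ds \<subseteq> {a..u}"
      "\<And>t. t \<in> S \<Longrightarrow> a < t \<Longrightarrow> - f t * prod_list (map (\<lambda>d. d - t) ds) \<le> 0"
      by fastforce
    have "f t * prod_list (map (\<lambda>d. d - t) (a # ds)) \<le> 0" if t: "t \<in> S" for t
    proof (cases t a rule: linorder_cases)
      case less
      have "0 \<le> prod_list (map (\<lambda>d. d - t) (a # ds))"
        using ds(2) less by (intro prod_list_nonneg) auto
      then show ?thesis using left[OF t less] by (simp add: mult_nonpos_nonneg)
    next
      case greater
      have "(t - a) * (- f t * prod_list (map (\<lambda>d. d - t) ds)) \<le> 0"
        using greater by (intro mult_nonneg_nonpos[OF _ ds(3)[OF t greater]]) simp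
      then show ?thesis by (simp add: algebra_simps)
    qed simp
    then show ?thesis
      using ds(1,2) a by (intro exI[of _ "a # ds"]) auto
  qed
qed

section \<open>Products of sines of half angles\<close>

text \<open>
  The next two lemmas transfer the sign pattern of the polynomial with zeros \<open>d\<close> to a product of sines.
  The multiplier may be zero, as it is for \<open>t = 0\<close> and \<open>d = 2 * pi\<close>.
\<close>

lemma sin_half_sign:
  fixes t d :: real
  assumes "t \<in> {0..2*pi}" "d \<in> {0..2*pi}"
  obtains c where "c \<ge> 0" "sin ((d - t) / 2) = c * (d - t)"
proof (cases d t rule: linorder_cases)
  case equal
  then show ?thesis using that[of 0] by simp
next
  case less
  have "sin ((t - d) / 2) \<ge> 0" using assms less by (intro sin_ge_zero) auto
  moreover have "sin ((d - t) / 2) = - sin ((t - d) / 2)"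
    by (metis minus_diff_eq minus_divide_left sin_minus)
  ultimately show ?thesis using less that[of "sin ((t - d) / 2) / (t - d)"]
    by (auto simp: field_simps)
next
  case greater
  have "sin ((d - t) / 2) \<ge> 0" using assms greater by (intro sin_ge_zero) auto
  then show ?thesis using greater that[of "sin ((d - t) / 2) / (d - t)"] by (auto simp: field_simps)
qed

lemma sin_product_sign:
  fixes t :: real
  assumes "t \<in> {0..2*pi}" "set ds \<subseteq> {0..2*pi}"
  obtains c where "c \<ge> 0"
    "prod_list (map (\<lambda>d. sin ((d - t) / 2)) ds) = c * prod_list (map (\<lambda>d. d - t) ds)"
proof -
  have "\<exists>c\<ge>0. prod_list (map (\<lambda>d. sin ((d - t) / 2)) ds) = c * prod_list (map (\<lambda>d. d - t) ds)"
    using assms(2)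
  proof (induction ds)
    case Nil
    show ?case by (intro exI[of _ 1]) auto
  next
    case (Cons d ds)
    obtain c1 where "c1 \<ge> 0" "sin ((d - t) / 2) = c1 * (d - t)"
      using sin_half_sign[of t d] assms(1) Cons.prems by auto
    moreover obtain c2 where "c2 \<ge> 0"
      "prod_list (map (\<lambda>d. sin ((d - t) / 2)) ds) = c2 * prod_list (map (\<lambda>d. d - t) ds)"
      using Cons by auto
    ultimately show ?case by (intro exI[of _ "c1 * c2"]) auto
  qed
  then show ?thesis using that by blast
qed

lemma two_sines:
  fixes a b t :: real
  shows "sin ((a - t) / 2) * sin ((b - t) / 2) = (cos ((a - b) / 2) - cos ((a + b) / 2 - t)) / 2"
proof -
  have "(a - t) / 2 - (b - t) / 2 = (a - b) / 2" "(a - t) / 2 + (b - t) / 2 = (a + b) / 2 - t"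
    by (auto simp: field_simps)
  then show ?thesis by (simp only: sin_times_sin)
qed

text \<open>
  A single factor \<open>sin ((a - t) / 2)\<close> is only antiperiodic; a product of two is a trigonometric
  polynomial of degree 1, which is why the cuts have to be used in pairs.
\<close>

lemma two_sines_eq_cis:
  "complex_of_real (sin ((a - t) / 2) * sin ((b - t) / 2)) =
     of_real (cos ((a - b) / 2)) / 2 - cis (- ((a + b) / 2)) / 4 * cis t
       - cis ((a + b) / 2) / 4 * cis (- t)"
proof -
  have "complex_of_real (cos ((a + b) / 2 - t))
      = (cis (- ((a + b) / 2)) * cis t + cis ((a + b) / 2) * cis (- t)) / 2"
    by (simp add: complex_eq_iff cos_diff)
  then show ?thesis
    unfolding two_sines by (simp add: diff_divide_distrib add_divide_distrib)
qed

section \<open>Orthogonality to trigonometric polynomials\<close>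

text \<open>
  Orthogonality of \<open>f\<close> to all trigonometric polynomials of degree at most \<open>m\<close> over one period.
  Integrability against every character, not only those of index at most \<open>m\<close>, is included so that
  the property passes to products of \<open>f\<close> with trigonometric polynomials.
\<close>

definition orthogonal_upto :: "nat \<Rightarrow> (real \<Rightarrow> complex) \<Rightarrow> bool" where
  "orthogonal_upto m f \<longleftrightarrow>
     (\<forall>k::int. (\<lambda>t. f t * cis (k * t)) integrable_on {0..2*pi}) \<and>
     (\<forall>k::int. \<bar>k\<bar> \<le> int m \<longrightarrow> integral {0..2*pi} (\<lambda>t. f t * cis (k * t)) = 0)"

text \<open>
  Multiplication by a trigonometric polynomial of degree 1 mixes only neighbouring coefficients, so
  it costs one degree of orthogonality. Transferring the factors to \<open>f\<close> in this way avoids expanding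
  the product of all of them.
\<close>

lemma orthogonal_upto_times_two_sines:
  assumes "orthogonal_upto (Suc m) f"
  shows "orthogonal_upto m (\<lambda>t. f t * of_real (sin ((a - t) / 2) * sin ((b - t) / 2)))"
proof -
  define g where "g = (\<lambda>(k::int) t. f t * cis (k * t))"
  define I where "I = (\<lambda>k::int. integral {0..2*pi} (g k))"
  define u v w :: complex
    where "u = of_real (cos ((a - b) / 2)) / 2" and "v = - cis (- ((a + b) / 2)) / 4"
      and "w = - cis ((a + b) / 2) / 4"
  have I: "(g k has_integral I k) {0..2*pi}" for k
    using assms unfolding orthogonal_upto_def I_def g_def by blast
  have eq: "f t * of_real (sin ((a - t) / 2) * sin ((b - t) / 2)) * cis (k * t)
      = u * g k t + v * g (k + 1) t + w * g (k - 1) t" for k :: int and t :: real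
    unfolding two_sines_eq_cis g_def u_def v_def w_def
    by (simp add: algebra_simps cis_mult)
  have int: "((\<lambda>t. f t * of_real (sin ((a - t) / 2) * sin ((b - t) / 2)) * cis (k * t)) has_integral
      u * I k + v * I (k + 1) + w * I (k - 1)) {0..2*pi}" for k :: int
    unfolding eq by (intro has_integral_add has_integral_mult_right I)
  have "I k = 0" if "\<bar>k\<bar> \<le> int (Suc m)" for k
    using assms that unfolding orthogonal_upto_def I_def g_def by blast
  then have "integral {0..2*pi} (\<lambda>t. f t * of_real (sin ((a - t) / 2) * sin ((b - t) / 2)) * cis (k * t)) = 0"
    if "\<bar>k\<bar> \<le> int m" for k :: int
    using int[of k] that by (auto dest!: integral_unique)
  then show ?thesis
    using int unfolding orthogonal_upto_def by blast
qed

lemma orthogonal_upto_times_sines: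
  assumes "orthogonal_upto (m + s) f" "length ds = 2 * s"
  shows "orthogonal_upto m (\<lambda>t. f t * of_real (prod_list (map (\<lambda>d. sin ((d - t) / 2)) ds)))"
  using assms
proof (induction s arbitrary: f ds)
  case 0
  then show ?case by simp
next
  case (Suc s)
  then obtain a b ds' where ds: "ds = a # b # ds'" "length ds' = 2 * s"
    by (auto simp: length_Suc_conv)
  from Suc.IH[OF orthogonal_upto_times_two_sines ds(2), of f a b] Suc.prems(1)
  show ?case by (simp add: ds(1) mult_ac)
qed

lemma orthogonal_upto_imp_integral_0:
  assumes "orthogonal_upto m f"
  shows "(f has_integral 0) {0..2*pi}"
proof -
  have "(\<lambda>t. f t * cis (of_int 0 * t)) integrable_on {0..2*pi}"
    using assms unfolding orthogonal_upto_def by blast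
  moreover have "integral {0..2*pi} (\<lambda>t. f t * cis (of_int 0 * t)) = 0"
    using assms unfolding orthogonal_upto_def by (metis abs_zero of_nat_0_le_iff)
  ultimately have "((\<lambda>t. f t * cis (of_int 0 * t)) has_integral 0) {0..2*pi}"
    unfolding has_integral_iff by blast
  then show ?thesis by simp
qed

lemma continuous_on_prod_list_sin:
  "continuous_on S (\<lambda>t::real. prod_list (map (\<lambda>d. sin ((d - t) / 2)) ds))"
  by (induction ds) (auto intro!: continuous_intros)

text \<open>
  If \<open>g\<close> did not alternate so often, at most \<open>2 * n\<close> cuts \<open>d\<close> would make \<open>g t\<close> times
  the product of the \<open>sin ((d - t) / 2)\<close> nonpositive. Its integral is zero by orthogonality, so the product of sines
  would vanish on the whole interval where \<open>g\<close> is a nonzero constant, which is absurd.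
\<close>

lemma orthogonal_upto_alternates:
  fixes g :: "real \<Rightarrow> real"
  assumes orth: "orthogonal_upto n (\<lambda>t. of_real (g t))"
    and uv: "u < v" "{u..v} \<subseteq> {0..2*pi}" and g: "\<And>t. t \<in> {u..v} \<Longrightarrow> g t = c" and c: "c \<noteq> 0"
  shows "alternates (2 * n + 1) g {0..2*pi}"
proof (rule ccontr)
  assume "\<not> ?thesis"
  then obtain ds where ds: "length ds \<le> 2 * n" "set ds \<subseteq> {0..2*pi}"
    "\<And>t. t \<in> {0..2*pi} \<Longrightarrow> g t * prod_list (map (\<lambda>d. d - t) ds) \<le> 0"
    using sign_change_points[of "2 * n" g "{0..2*pi}" 0 "2*pi"] by auto
  (* An odd number of cuts is at most 2 * n - 1, so there is room for one more. The cut 2 * pi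
     changes no sign: its factor is sin (t / 2), which is nonnegative on the period. *)
  define es where "es = (if even (length ds) then ds else 2 * pi # ds)"
  define T where "T = (\<lambda>t. prod_list (map (\<lambda>d. sin ((d - t) / 2)) es))"
  have es: "set es \<subseteq> {0..2*pi}" using ds(2) by (auto simp: es_def)
  obtain s where s: "length es = 2 * s" "s \<le> n"
  proof -
    have "even (length es)" "length es \<le> 2 * n"
      using ds(1) by (auto simp: es_def) presburger
    then show thesis using that by (auto elim!: evenE)
  qed
  have sign: "g t * T t \<le> 0" if t: "t \<in> {0..2*pi}" for t
  proof -
    obtain k where k: "k \<ge> 0"
      "prod_list (map (\<lambda>d. sin ((d - t) / 2)) ds) = k * prod_list (map (\<lambda>d. d - t) ds)"
      using sin_product_sign[OF t ds(2)] by blast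
    obtain l where l: "l \<ge> 0" "T t = l * prod_list (map (\<lambda>d. sin ((d - t) / 2)) ds)"
    proof (cases "even (length ds)")
      case True
      then show ?thesis using that[of 1] by (simp add: T_def es_def)
    next
      case False
      have "sin ((2 * pi - t) / 2) \<ge> 0" using t by (intro sin_ge_zero) auto
      then show ?thesis using that[of "sin ((2 * pi - t) / 2)"] False by (simp add: T_def es_def)
    qed
    have "g t * T t = (l * k) * (g t * prod_list (map (\<lambda>d. d - t) ds))"
      using k l by simp
    also have "\<dots> \<le> 0" using k(1) l(1) by (intro mult_nonneg_nonpos[OF _ ds(3)[OF t]]) simp
    finally show ?thesis .
  qed
  have orth_T: "orthogonal_upto (n - s) (\<lambda>t. of_real (g t) * of_real (T t))"
    unfolding T_def using orth s by (intro orthogonal_upto_times_sines[of _ s]) auto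
  have "((\<lambda>t. complex_of_real (g t) * of_real (T t)) has_integral 0) {0..2*pi}"
    using orth_T by (rule orthogonal_upto_imp_integral_0)
  from has_integral_Re[OF this] have int: "((\<lambda>t. - (g t * T t)) has_integral 0) {0..2*pi}"
    using has_integral_neg[of "\<lambda>t. g t * T t" 0] by simp
  have int_uv: "(\<lambda>t. - (g t * T t)) integrable_on {u..v}"
    by (rule integrable_on_subinterval[OF has_integral_integrable[OF int] uv(2)])
  have "integral {u..v} (\<lambda>t. - (g t * T t)) \<le> integral {0..2*pi} (\<lambda>t. - (g t * T t))"
    using int int_uv uv(2) sign by (intro integral_subset_le) auto
  moreover have "integral {u..v} (\<lambda>t. - (g t * T t)) \<ge> 0"
    using int_uv uv(2) sign by (intro integral_nonneg) auto
  ultimately have "((\<lambda>t. - (g t * T t)) has_integral 0) {u..v}"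
    using int int_uv by (simp add: has_integral_iff)
  then have "((\<lambda>t. - (c * T t)) has_integral 0) {u..v}"
    by (rule has_integral_eq[rotated]) (simp add: g)
  then have int_0: "((\<lambda>t. - (c * T t)) has_integral 0) (cbox u v)" by simp
  have T_cont: "continuous_on (cbox u v) (\<lambda>t. - (c * T t))"
    unfolding T_def by (intro continuous_intros continuous_on_prod_list_sin)
  have cT: "0 \<le> - (c * T t)" if "t \<in> cbox u v" for t
    using sign[of t] g[of t] that uv(2) by (simp add: subset_eq)
  have T0: "- (c * T t) = 0" if "t \<in> {u..v}" for t
    using has_integral_0_cbox_imp_0[OF T_cont cT int_0] that uv(1) by simp
  (* The endpoints come in because the cut 2 * pi also gives a zero at 0, and 0 one at 2 * pi. *)
  have "{u..v} \<subseteq> {0, 2 * pi} \<union> set es"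
  proof
    fix t assume t: "t \<in> {u..v}"
    then have "T t = 0" using T0 c by simp
    then obtain d where d: "d \<in> set es" "sin ((d - t) / 2) = 0"
      by (auto simp: T_def prod_list_zero_iff)
    then have "d \<in> {0..2*pi}" "t \<in> {0..2*pi}" using es t uv(2) by auto
    then show "t \<in> {0, 2 * pi} \<union> set es"
      using d sin_eq_0_pi[of "(d - t) / 2"] by (cases "t = 0 \<or> t = 2 * pi") auto
  qed
  then have "finite {u..v}" by (rule finite_subset) simp
  then show False using uv(1) infinite_Icc by blast
qed

section \<open>Arcs and separation on the circle\<close>

lemma cis_in_period:
  assumes "z \<in> unit_circle"
  obtains t where "z = cis t" "c \<le> t" "t < c + 2 * pi"
proof
  have "norm (z * cis (- c)) = 1" using assms by (simp add: norm_mult)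
  then have "z * cis (- c) = cis (Arg2pi (z * cis (- c)))"
    using Arg2pi_eq[of "z * cis (- c)"] by (simp add: cis_conv_exp)
  then have "z * cis (- c) * cis c = cis (c + Arg2pi (z * cis (- c)))"
    by (metis cis_mult mult.commute)
  then show "z = cis (c + Arg2pi (z * cis (- c)))"
    by (simp add: mult.assoc cis_mult)
qed (auto simp: Arg2pi_ge_0 Arg2pi_lt_2pi)

text \<open>
  The chord through \<open>cis q1\<close> and \<open>cis q2\<close> separates \<open>cis p1\<close> from \<open>cis p2\<close>. The affine function
  \<open>h\<close> that vanishes on the chord is the product of two sines of half angles on the circle, and it
  has a zero on every connected set that meets both sides.
\<close>

lemma connected_not_separated:
  fixes A :: "complex set"
  assumes A: "connected A" "A \<subseteq> unit_circle"
    and p: "cis p1 \<in> A" "cis p2 \<in> A" and q: "cis q1 \<notin> A" "cis q2 \<notin> A"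
    and order: "p1 \<le> q1" "q1 \<le> p2" "p2 \<le> q2" "q2 \<le> p1 + 2 * pi"
  shows False
proof -
  have ne: "p1 \<noteq> q1" "q1 \<noteq> p2" "p2 \<noteq> q2" "q2 \<noteq> p1 + 2 * pi"
    using p q by (auto simp flip: cis_mult)
  define h :: "complex \<Rightarrow> real" where
    "h = (\<lambda>z. (cos ((q1 - q2) / 2) - Re (z * cis (- ((q1 + q2) / 2)))) / 2)"
  have h: "h (cis t) = sin ((q1 - t) / 2) * sin ((q2 - t) / 2)" for t
    unfolding h_def two_sines by (simp add: cis_mult cos_diff)
  have "h (cis p1) > 0"
    unfolding h using order ne by (intro mult_pos_pos sin_gt_zero) auto
  moreover have "h (cis p2) < 0"
  proof -
    have "sin ((p2 - q1) / 2) > 0" using order ne by (intro sin_gt_zero) auto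
    moreover have "sin ((q1 - p2) / 2) = - sin ((p2 - q1) / 2)"
      by (metis minus_diff_eq minus_divide_left sin_minus)
    moreover have "sin ((q2 - p2) / 2) > 0" using order ne by (intro sin_gt_zero) auto
    ultimately show ?thesis unfolding h by (simp add: mult_neg_pos)
  qed
  moreover have "connected (h ` A)"
    unfolding h_def by (intro connected_continuous_image A(1) continuous_intros) auto
  ultimately have "0 \<in> h ` A"
    using p connectedD_interval[of "h ` A" "h (cis p2)" "h (cis p1)" 0] by force
  then obtain z where z: "z \<in> A" "h z = 0" by auto
  (* With angles measured from p1, q1 - t and q2 - t lie strictly between - 2 * pi and 2 * pi, so a
     vanishing sine factor forces t to be q1 or q2. *)
  obtain t where t: "z = cis t" "p1 \<le> t" "t < p1 + 2 * pi"
    using cis_in_period[of z p1] z(1) A(2) by blast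
  have "sin ((q1 - t) / 2) = 0 \<or> sin ((q2 - t) / 2) = 0"
    using z h t by auto
  then have "t = q1 \<or> t = q2"
    using sin_eq_0_pi[of "(q1 - t) / 2"] sin_eq_0_pi[of "(q2 - t) / 2"] t(2,3) order ne by auto
  then show False using z(1) t(1) q by auto
qed

text \<open>
  By the preceding lemma no two of the \<open>n + 1\<close> points with even index share an arc.
\<close>

lemma not_alternating_in_union_of_arcs:
  assumes E: "union_of_arcs m E" "m \<le> n"
    and x: "\<And>i j. i < j \<Longrightarrow> j < 2 * n + 2 \<Longrightarrow> x i < x j"
      "\<And>i. i < 2 * n + 2 \<Longrightarrow> x i \<in> {0..2*pi}"
    and even: "\<And>i. i \<le> n \<Longrightarrow> cis (x (2 * i)) \<in> E"
    and odd: "\<And>i. i \<le> n \<Longrightarrow> cis (x (2 * i + 1)) \<notin> E"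
  shows False
proof -
  have "E \<noteq> unit_circle" using odd[of 0] by auto
  then obtain \<A> where \<A>: "finite \<A>" "card \<A> = m" "\<And>A. A \<in> \<A> \<Longrightarrow> circle_arc A" "E = \<Union>\<A>"
    using E(1) unfolding union_of_arcs_def by auto
  have "\<forall>i\<in>{..n}. \<exists>A\<in>\<A>. cis (x (2 * i)) \<in> A" using even \<A>(4) by blast
  then obtain a where a: "\<And>i. i \<le> n \<Longrightarrow> a i \<in> \<A> \<and> cis (x (2 * i)) \<in> a i"
    by (metis atMost_iff)
  have neq: "a i \<noteq> a j" if "i < j" "j \<le> n" for i j
  proof
    assume eq: "a i = a j"
    have "connected (a i)" "a i \<subseteq> unit_circle"
      using \<A>(3) a[of i] that by (auto simp: circle_arc_def)
    moreover have "cis (x (2 * i)) \<in> a i" "cis (x (2 * j)) \<in> a i"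
      using a[of i] a[of j] that eq by auto
    moreover have "cis (x (2 * i + 1)) \<notin> a i" "cis (x (2 * j + 1)) \<notin> a i"
      using odd[of i] odd[of j] a[of i] \<A>(4) that by auto
    moreover have "x (2 * i) \<le> x (2 * i + 1)" "x (2 * i + 1) \<le> x (2 * j)" "x (2 * j) \<le> x (2 * j + 1)"
      using that by (auto intro!: less_imp_le x(1))
    moreover have "x (2 * j + 1) \<le> x (2 * i) + 2 * pi"
      using x(2)[of "2 * i"] x(2)[of "2 * j + 1"] that by auto
    ultimately show False by (rule connected_not_separated)
  qed
  then have "inj_on a {..n}"
    by (intro inj_onI) (metis atMost_iff linorder_neqE_nat)
  moreover have "a ` {..n} \<subseteq> \<A>" using a by auto
  ultimately have "card {..n} \<le> card \<A>" using \<A>(1) by (metis card_image card_mono)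
  then show False using \<A>(2) E(2) by simp
qed

section \<open>Alternations of a difference of characteristic functions\<close>

definition char_diff :: "complex set \<Rightarrow> complex set \<Rightarrow> real \<Rightarrow> real" where
  "char_diff E F t = indicator E (cis t) - indicator F (cis t)"

lemma char_diff_swap: "char_diff F E t = - char_diff E F t"
  by (simp add: char_diff_def)

lemma char_diff_pos_iff: "char_diff E F t > 0 \<longleftrightarrow> cis t \<in> E \<and> cis t \<notin> F"
  by (auto simp: char_diff_def indicator_def)

lemma not_alternates_char_diff:
  assumes "\<exists>m\<le>n. union_of_arcs m E"
  shows "\<not> alternates (2 * n + 2) (char_diff E F) {0..2*pi}"
proof
  assume "alternates (2 * n + 2) (char_diff E F) {0..2*pi}"
  then obtain x where mono: "\<And>i j. i < j \<Longrightarrow> j < 2 * n + 2 \<Longrightarrow> x i < x j"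
    and x: "\<And>i. i < 2 * n + 2 \<Longrightarrow> x i \<in> {0..2*pi} \<and> (-1) ^ i * char_diff E F (x i) > 0"
    unfolding alternates_def by blast
  obtain m where "m \<le> n" "union_of_arcs m E" using assms by blast
  moreover have "cis (x (2 * i)) \<in> E" if "i \<le> n" for i
    using x[of "2 * i"] that by (simp add: char_diff_pos_iff)
  moreover have "cis (x (2 * i + 1)) \<notin> E" if "i \<le> n" for i
    using x[of "2 * i + 1"] that by (auto simp: char_diff_def indicator_def split: if_splits)
  ultimately show False
    using not_alternating_in_union_of_arcs[of m E n x] mono x by blast
qed

text \<open>
  Two alternations of length \<open>2 * n + 1\<close> with opposite first signs would give one of length
  \<open>2 * n + 2\<close>: the earlier first point precedes the whole other sequence and has the right sign.
\<close>

lemma not_alternates_one_sign: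
  assumes "\<exists>m\<le>n. union_of_arcs m E" "\<exists>m\<le>n. union_of_arcs m F"
  shows "\<not> alternates (2 * n + 1) (char_diff E F) {0..2*pi} \<or>
    \<not> alternates (2 * n + 1) (char_diff F E) {0..2*pi}"
proof (rule ccontr)
  assume neg: "\<not> ?thesis"
  obtain x where x: "\<And>i j. i < j \<Longrightarrow> j < 2 * n + 1 \<Longrightarrow> x i < x j"
    "\<And>i. i < 2 * n + 1 \<Longrightarrow> x i \<in> {0..2*pi} \<and> (-1) ^ i * char_diff E F (x i) > 0"
    using neg unfolding alternates_def by blast
  obtain y where y: "\<And>i j. i < j \<Longrightarrow> j < 2 * n + 1 \<Longrightarrow> y i < y j"
    "\<And>i. i < 2 * n + 1 \<Longrightarrow> y i \<in> {0..2*pi} \<and> (-1) ^ i * char_diff F E (y i) > 0"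
    using neg unfolding alternates_def by blast
  have pos: "char_diff E F (x 0) > 0" "char_diff F E (y 0) > 0"
    using x(2)[of 0] y(2)[of 0] by auto
  then have "x 0 \<noteq> y 0" by (auto simp: char_diff_pos_iff)
  then consider "x 0 < y 0" | "y 0 < x 0" by linarith
  then show False
  proof cases
    case 1
    have "alternates (Suc (2 * n + 1)) (char_diff E F) {0..2*pi}"
      using 1 pos x(2)[of 0] y(2)
      by (intro alternates_prepend[of "x 0" _ _ _ y] y(1)) (auto simp: char_diff_swap[of F E])
    then show False using not_alternates_char_diff[OF assms(1)] by simp
  next
    case 2
    have "alternates (Suc (2 * n + 1)) (char_diff F E) {0..2*pi}"
      using 2 pos y(2)[of 0] x(2)
      by (intro alternates_prepend[of "y 0" _ _ _ x] x(1)) (auto simp: char_diff_swap[of E F])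
    then show False using not_alternates_char_diff[OF assms(2)] by simp
  qed
qed

section \<open>Differences contain intervals\<close>

lemma union_of_arcs_subset:
  assumes "union_of_arcs m E"
  shows "E \<subseteq> unit_circle"
  using assms unfolding union_of_arcs_def circle_arc_def by blast

lemma closed_union_of_arcs:
  assumes "union_of_arcs m E"
  shows "closed E"
  using assms unfolding union_of_arcs_def circle_arc_def by auto

text \<open>
  The point \<open>cis s\<close> and another point \<open>cis r\<close> of \<open>A\<close> cut the circle into two arcs; as \<open>A\<close> is not
  separated, it contains one of them. Only a one-sided interval can be had, for \<open>cis s\<close> may be an
  endpoint of \<open>A\<close>.
\<close>

lemma connected_contains_one_sided_interval:
  assumes A: "connected A" "A \<subseteq> unit_circle" "\<not> is_singleton A" and s: "cis s \<in> A"
  obtains \<delta> where "\<delta> > 0" "(\<forall>t\<in>{s..s+\<delta>}. cis t \<in> A) \<or> (\<forall>t\<in>{s-\<delta>..s}. cis t \<in> A)"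
proof -
  obtain w where w: "w \<in> A" "w \<noteq> cis s"
    using A(3) s is_singletonI'[of A] by (metis empty_iff)
  obtain r where r: "w = cis r" "s \<le> r" "r < s + 2 * pi"
    using cis_in_period[of w s] w(1) A(2) by blast
  have "s < r" using r w(2) by (cases "s = r") auto
  have "(\<forall>t\<in>{s..r}. cis t \<in> A) \<or> (\<forall>t\<in>{r..s + 2 * pi}. cis t \<in> A)"
    using connected_not_separated[OF A(1,2) s, of r] w(1) r(1) by (meson atLeastAtMost_iff)
  then consider "\<forall>t\<in>{s..r}. cis t \<in> A" | "\<forall>t\<in>{r..s + 2 * pi}. cis t \<in> A" by blast
  then show thesis
  proof cases
    case 1
    then show ?thesis using that[of "r - s"] \<open>s < r\<close> by simp
  next
    case 2
    have "cis t \<in> A" if "t \<in> {s - (s + 2 * pi - r)..s}" for t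
    proof -
      have "cis (t + 2 * pi) \<in> A" using 2 that by auto
      then show ?thesis by (simp flip: cis_mult)
    qed
    then show ?thesis using that[of "s + 2 * pi - r"] r(3) by simp
  qed
qed

text \<open>
  Since \<open>F\<close> is closed, a short one-sided interval of \<open>E\<close> at the point \<open>z\<close> avoids \<open>F\<close>. It is placed
  inside the base period because that is where the integrals of the Fourier coefficients are taken.
\<close>

lemma interval_in_difference:
  assumes E: "union_of_arcs m E" and F: "closed F" and z: "z \<in> E" "z \<notin> F"
  obtains u v where "u < v" "{u..v} \<subseteq> {0..2*pi}" "\<And>t. t \<in> {u..v} \<Longrightarrow> cis t \<in> E - F"
proof -
  have "z \<in> unit_circle" using union_of_arcs_subset[OF E] z(1) by blast
  then obtain s where s: "z = cis s" using cis_in_period[of z 0] by blast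
  have "\<exists>\<delta>>0. (\<forall>t\<in>{s..s+\<delta>}. cis t \<in> E) \<or> (\<forall>t\<in>{s-\<delta>..s}. cis t \<in> E)"
  proof (cases "E = unit_circle")
    case True
    then show ?thesis by (intro exI[of _ 1]) auto
  next
    case False
    then obtain A where A: "circle_arc A" "z \<in> A" "A \<subseteq> E"
      using E z(1) by (auto simp: union_of_arcs_def)
    then obtain \<delta> where "\<delta> > 0" "(\<forall>t\<in>{s..s+\<delta>}. cis t \<in> A) \<or> (\<forall>t\<in>{s-\<delta>..s}. cis t \<in> A)"
      using connected_contains_one_sided_interval[of A s] s by (auto simp: circle_arc_def)
    then show ?thesis using A(3) by blast
  qed
  then obtain \<delta> where \<delta>: "\<delta> > 0" "(\<forall>t\<in>{s..s+\<delta>}. cis t \<in> E) \<or> (\<forall>t\<in>{s-\<delta>..s}. cis t \<in> E)"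
    by blast
  have "open (cis -` (- F))"
    using F by (intro open_vimage continuous_intros) auto
  moreover have "s \<in> cis -` (- F)" using z(2) s by simp
  ultimately obtain \<epsilon> where \<epsilon>: "\<epsilon> > 0" "\<And>t. \<bar>t - s\<bar> \<le> \<epsilon> \<Longrightarrow> cis t \<notin> F"
    unfolding open_contains_cball
    by (force simp: dist_real_def subset_eq abs_minus_commute)
  define \<eta> where "\<eta> = min \<delta> \<epsilon>"
  have \<eta>: "\<eta> > 0" using \<delta>(1) \<epsilon>(1) by (simp add: \<eta>_def)
  have "\<exists>a. \<forall>t\<in>{a..a + \<eta>}. cis t \<in> E \<and> \<bar>t - s\<bar> \<le> \<eta>"
    using \<delta>(2)
  proof
    assume "\<forall>t\<in>{s..s+\<delta>}. cis t \<in> E"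
    then show ?thesis by (intro exI[of _ s]) (auto simp: \<eta>_def)
  next
    assume "\<forall>t\<in>{s-\<delta>..s}. cis t \<in> E"
    then show ?thesis by (intro exI[of _ "s - \<eta>"]) (auto simp: \<eta>_def)
  qed
  then obtain a where a: "\<And>t. t \<in> {a..a + \<eta>} \<Longrightarrow> cis t \<in> E - F"
    using \<epsilon>(2) by (fastforce simp: \<eta>_def)
  (* Move the left endpoint into the base period and cut the interval off at its end. *)
  have "cis a \<in> unit_circle" by simp
  then obtain u where u: "cis a = cis u" "0 \<le> u" "u < 2 * pi"
    using cis_in_period[of "cis a" 0] by auto
  show thesis
  proof (rule that[of u "min (u + \<eta>) (2 * pi)"])
    fix t assume t: "t \<in> {u..min (u + \<eta>) (2 * pi)}"
    have "cis t = cis u * cis (t - u)" by (simp add: cis_mult)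
    also have "\<dots> = cis (a + (t - u))" by (simp add: cis_mult flip: u(1))
    finally show "cis t \<in> E - F" using a[of "a + (t - u)"] t by auto
  qed (use u \<eta> in auto)
qed

section \<open>Determination by Fourier coefficients\<close>

lemma indicator_times_cis_integrable:
  assumes "closed E"
  shows "(\<lambda>t. indicator E (cis t) * cis (of_int k * t)) integrable_on {a..b::real}"
proof -
  define S where "S = {a..b} \<inter> cis -` E"
  have "closed (cis -` E)" using assms by (intro closed_vimage continuous_intros)
  then have "compact S" unfolding S_def by (simp add: compact_Int_closed)
  then have "integrable lborel (\<lambda>t. indicator S t *\<^sub>R cis (of_int k * t))"
    by (rule borel_integrable_compact) (intro continuous_intros)
  then have "(\<lambda>t. indicator S t *\<^sub>R cis (of_int k * t)) integrable_on UNIV"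
    using has_integral_integral_lborel by blast
  moreover have "(\<lambda>t. indicator S t *\<^sub>R cis (of_int k * t))
      = (\<lambda>t. if t \<in> {a..b} then indicator E (cis t) * cis (of_int k * t) else 0)"
    by (auto simp: S_def indicator_def)
  ultimately show ?thesis
    using integrable_restrict_UNIV[of "{a..b}" "\<lambda>t. indicator E (cis t) * cis (of_int k * t)"]
    by simp
qed

lemma fourier_coeff_cis:
  "fourier_coeff E k =
     integral {0..2*pi} (\<lambda>t. indicator E (cis t) * cis (of_int (- k) * t)) / (2 * of_real pi)"
  by (simp add: fourier_coeff_def cis_conv_exp mult.assoc)

lemma orthogonal_upto_char_diff:
  assumes closed: "closed E" "closed F"
    and eq: "\<And>k :: int. 0 \<le> k \<Longrightarrow> k \<le> int n \<Longrightarrow> fourier_coeff E k = fourier_coeff F k"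
  shows "orthogonal_upto n (\<lambda>t. of_real (char_diff E F t))"
proof -
  define h where "h = (\<lambda>(k::int) t. complex_of_real (char_diff E F t) * cis (k * t))"
  have h: "h k = (\<lambda>t. indicator E (cis t) * cis (of_int k * t) - indicator F (cis t) * cis (of_int k * t))"
    for k by (auto simp: h_def char_diff_def indicator_def)
  have int: "h k integrable_on {0..2*pi}" for k
    unfolding h by (intro integrable_diff indicator_times_cis_integrable closed)
  have neg: "integral {0..2*pi} (h (- k)) = 0" if "0 \<le> k" "k \<le> int n" for k
    using eq[OF that] indicator_times_cis_integrable[OF closed(1), of "- k" 0 "2 * pi"]
      indicator_times_cis_integrable[OF closed(2), of "- k" 0 "2 * pi"]
    unfolding h fourier_coeff_cis by (subst integral_diff) auto
  have "integral {0..2*pi} (h k) = 0" if "\<bar>k\<bar> \<le> int n" for k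
  proof (cases "k \<le> 0")
    case True
    then show ?thesis using neg[of "- k"] that by simp
  next
    case False
    have "h k = (\<lambda>t. cnj (h (- k) t))" by (auto simp: h_def cis_cnj)
    then show ?thesis using neg[of k] that False by (simp flip: integral_cnj)
  qed
  then show ?thesis using int unfolding orthogonal_upto_def h_def by blast
qed

lemma union_of_arcs_subset_of_fourier_coeff_eq:
  assumes E: "\<exists>m\<le>n. union_of_arcs m E" and F: "\<exists>m\<le>n. union_of_arcs m F"
    and eq: "\<And>k :: int. 0 \<le> k \<Longrightarrow> k \<le> int n \<Longrightarrow> fourier_coeff E k = fourier_coeff F k"
  shows "E \<subseteq> F"
proof (rule ccontr)
  assume "\<not> E \<subseteq> F"
  then obtain z where z: "z \<in> E" "z \<notin> F" by blast
  have closed: "closed E" "closed F" using E F closed_union_of_arcs by blast+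
  obtain u v where uv: "u < v" "{u..v} \<subseteq> {0..2*pi}" "\<And>t. t \<in> {u..v} \<Longrightarrow> cis t \<in> E - F"
    using interval_in_difference[OF _ closed(2) z] E by blast
  have "alternates (2 * n + 1) (char_diff E F) {0..2*pi}"
    using uv(3) by (intro orthogonal_upto_alternates[OF _ uv(1,2), of _ _ 1]
        orthogonal_upto_char_diff closed eq) (auto simp: char_diff_def)
  moreover have "alternates (2 * n + 1) (char_diff F E) {0..2*pi}"
    using uv(3) by (intro orthogonal_upto_alternates[OF _ uv(1,2), of _ _ "- 1"]
        orthogonal_upto_char_diff closed eq[symmetric]) (auto simp: char_diff_def)
  ultimately show False using not_alternates_one_sign[OF E F] by blast
qed

theorem theorem1:
  fixes n :: nat and E\<^sub>1 E\<^sub>2 :: "complex set"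
  assumes "E\<^sub>1 \<subseteq> unit_circle" and "E\<^sub>2 \<subseteq> unit_circle"
    and "\<exists>m\<le>n. union_of_arcs m E\<^sub>1" and "\<exists>m\<le>n. union_of_arcs m E\<^sub>2"
    and "\<And>k :: int. 0 \<le> k \<Longrightarrow> k \<le> int n \<Longrightarrow> fourier_coeff E\<^sub>1 k = fourier_coeff E\<^sub>2 k"
  shows "E\<^sub>1 = E\<^sub>2"
  using union_of_arcs_subset_of_fourier_coeff_eq[OF assms(3,4,5)]
    union_of_arcs_subset_of_fourier_coeff_eq[OF assms(4,3) assms(5)[symmetric]] by blast

end
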